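(* Any data structure of size $\tilde{\mathcal{O}}(n)$ for maintaining a longest common substring of a dynamic string $S$ (undergoing single-letter substitutions) and a static string $T$, each of length at most $n$, requires $\Omega(\log n/\log\log n)$ time per update operation.
   Context: $\tilde{\mathcal{O}}(n)$ means $n\cdot\log^{\mathcal{O}(1)} n$. A longest common substring of two strings is a longest string occurring as a substring of both. The lower bound is for data structures in the cell-probe/word-RAM model with words of $\Theta(\log n)$ bits. *)

theory Defs
  imports Complex_Main
begin

text \<open>Cell-probe model. Memory is a map from addresses to natural numbers; a structure
  with s cells of w bits only ever accesses address (i mod s) and only ever sees/stores
  values modulo 2^w. An operation is an adaptive decision tree of cell probes.\<close>

datatype 'a probe_tree =
    Leaf 'a
  | Read nat "nat \<Rightarrow> 'a probe_tree"
  | Write nat nat "'a probe_tree"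

type_synonym mem = "nat \<Rightarrow> nat"

primrec exec :: "nat \<Rightarrow> nat \<Rightarrow> 'a probe_tree \<Rightarrow> mem \<Rightarrow> 'a \<times> mem \<times> nat" where
  "exec s w (Leaf a) m = (a, m, 0)"
| "exec s w (Read i f) m =
     (case exec s w (f (m (i mod s) mod 2 ^ w)) m of (a, m', c) \<Rightarrow> (a, m', Suc c))"
| "exec s w (Write i v t) m =
     (case exec s w t (m(i mod s := v mod 2 ^ w)) of (a, m', c) \<Rightarrow> (a, m', Suc c))"

definition common_substring :: "nat list \<Rightarrow> nat list \<Rightarrow> nat \<times> nat \<times> nat \<Rightarrow> bool" where
  "common_substring S T x = (case x of (i, j, l) \<Rightarrow>
     i + l \<le> length S \<and> j + l \<le> length T \<and> take l (drop i S) = take l (drop j T))"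

definition is_lcs :: "nat list \<Rightarrow> nat list \<Rightarrow> nat \<times> nat \<times> nat \<Rightarrow> bool" where
  "is_lcs S T x = (common_substring S T x \<and>
     (\<forall>i' j' l'. common_substring S T (i', j', l') \<longrightarrow> l' \<le> snd (snd x)))"

definition str_n :: "nat \<Rightarrow> nat list \<Rightarrow> bool" where
  "str_n n S = (length S \<le> n \<and> set S \<subseteq> {0..<n})"

inductive reach :: "nat \<Rightarrow> nat \<Rightarrow> nat \<Rightarrow> (nat list \<Rightarrow> nat list \<Rightarrow> mem)
     \<Rightarrow> (nat \<Rightarrow> nat \<Rightarrow> (nat \<times> nat \<times> nat) probe_tree) \<Rightarrow> nat list \<Rightarrow> nat list \<times> mem \<Rightarrow> bool"
  for n s w init upd T where
  start: "str_n n S0 \<Longrightarrow> reach n s w init upd T (S0, init S0 T)"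
| step: "reach n s w init upd T (S, m) \<Longrightarrow> j < length S \<Longrightarrow> a < n \<Longrightarrow>
     exec s w (upd j a) m = (ans, m', c) \<Longrightarrow> reach n s w init upd T (S[j := a], m')"

text \<open>A (deterministic, cell-probe) data structure with s cells of w bits, arbitrary
  preprocessing init, and update procedure upd j a (substitute S[j] := a) which outputs
  a longest common substring of the updated S and the static T, correctly and with at
  most t cell probes (worst case) for every update sequence and all inputs S, T of
  length at most n over alphabet {0..<n}.\<close>
definition lcs_ds :: "nat \<Rightarrow> nat \<Rightarrow> nat \<Rightarrow> (nat list \<Rightarrow> nat list \<Rightarrow> mem)
     \<Rightarrow> (nat \<Rightarrow> nat \<Rightarrow> (nat \<times> nat \<times> nat) probe_tree) \<Rightarrow> nat \<Rightarrow> bool" where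
  "lcs_ds n s w init upd t = (0 < s \<and>
     (\<forall>T S m j a. str_n n T \<longrightarrow> reach n s w init upd T (S, m) \<longrightarrow> j < length S \<longrightarrow> a < n \<longrightarrow>
        (case exec s w (upd j a) m of (ans, m', c) \<Rightarrow> is_lcs (S[j := a]) T ans \<and> c \<le> t)))"

end

theory Submission
  imports Defs "HOL-Combinatorics.Permutations" "HOL-Library.Sublist" "HOL-Real_Asymp.Real_Asymp"
begin

text \<open>
  A single update after preprocessing is already hard. The static string lists the closed edges of
  \<open>A\<close> butterfly networks of degree \<open>2 * b\<close> and depth \<open>d\<close>, and the dynamic string contains a block
  \<open>x $ y\<close> for every source \<open>x\<close> and sink \<open>y\<close>. The path from \<open>x\<close> to \<open>y\<close> crosses level \<open>k\<close> along the edge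
  determined by the digits \<open>k, \<dots>\<close> of \<open>x\<close> and the digits \<open>0, \<dots>, k\<close> of \<open>y\<close>. Hence replacing \<open>$\<close> by the
  letter of butterfly \<open>a\<close> produces a common substring of length \<open>d + 2\<close> iff the path has a closed edge
  in \<open>a\<close>.

  The closed edges are encoded by a set \<open>D\<close> in such a way that for each \<open>D\<close> and each routing (a
  permutation of the \<open>b\<close> digit pairs for every switch) there are open paths that follow the routing
  and together visit every node of every level. If \<open>t\<close> were small, the queries for all these paths would
  probe a set of few cells, and there are few such sets. So some \<open>D\<close> has very many routings with
  one common cell set, and very many other \<open>D'\<close> show the same contents there. Each of these \<open>D'\<close>
  agrees with \<open>D\<close> on all edges used by the routings. Many routings use many edges, which leaves too
  little freedom for the sets \<open>D'\<close>.
\<close>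

subsection \<open>Probed cells\<close>

abbreviation answer :: "nat \<Rightarrow> nat \<Rightarrow> 'a probe_tree \<Rightarrow> mem \<Rightarrow> 'a" where
  "answer s w u m \<equiv> fst (exec s w u m)"

abbreviation cost :: "nat \<Rightarrow> nat \<Rightarrow> 'a probe_tree \<Rightarrow> mem \<Rightarrow> nat" where
  "cost s w u m \<equiv> snd (snd (exec s w u m))"

primrec probes :: "nat \<Rightarrow> nat \<Rightarrow> 'a probe_tree \<Rightarrow> mem \<Rightarrow> nat set" where
  "probes s w (Leaf a) m = {}"
| "probes s w (Read i f) m = insert (i mod s) (probes s w (f (m (i mod s) mod 2 ^ w)) m)"
| "probes s w (Write i v u) m = insert (i mod s) (probes s w u (m(i mod s := v mod 2 ^ w)))"

lemma finite_probes: "finite (probes s w u m)"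
  by (induction u arbitrary: m) auto

lemma probes_subset_lessThan: "0 < s \<Longrightarrow> probes s w u m \<subseteq> {..<s}"
  by (induction u arbitrary: m) auto

lemma card_probes_le_cost: "card (probes s w u m) \<le> cost s w u m"
proof (induction u arbitrary: m)
  case (Read i f)
  show ?case
    using Read[of "f (m (i mod s) mod 2 ^ w)" m]
    by (auto simp: card_insert_if finite_probes split: prod.splits)
next
  case (Write i v u)
  show ?case
    using Write[of "m(i mod s := v mod 2 ^ w)"]
    by (auto simp: card_insert_if finite_probes simp del: fun_upd_apply split: prod.splits)
qed simp

lemma answer_cong_probes:
  assumes "\<And>i. i \<in> probes s w u m \<Longrightarrow> m' i mod 2 ^ w = m i mod 2 ^ w"
  shows "answer s w u m' = answer s w u m"
  using assms
proof (induction u arbitrary: m m')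
  case (Read i f)
  let ?u = "f (m (i mod s) mod 2 ^ w)"
  have "m' (i mod s) mod 2 ^ w = m (i mod s) mod 2 ^ w"
    using Read.prems[of "i mod s"] by simp
  moreover have "answer s w ?u m' = answer s w ?u m"
    using Read.prems by (intro Read.IH) auto
  ultimately show ?case
    by (auto split: prod.splits)
next
  case (Write i v u)
  let ?upd = "\<lambda>m. m(i mod s := v mod 2 ^ w)"
  have "answer s w u (?upd m') = answer s w u (?upd m)"
  proof (rule Write.IH)
    fix j assume "j \<in> probes s w u (?upd m)"
    then have "m' j mod 2 ^ w = m j mod 2 ^ w"
      using Write.prems[of j] by (simp del: fun_upd_apply)
    then show "?upd m' j mod 2 ^ w = ?upd m j mod 2 ^ w"
      by simp
  qed
  then show ?case
    by (auto split: prod.splits)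
qed simp

subsection \<open>Counting\<close>

definition small_subsets :: "'a set \<Rightarrow> nat \<Rightarrow> 'a set set" where
  "small_subsets X r = {C. C \<subseteq> X \<and> card C \<le> r}"

lemma finite_small_subsets: "finite X \<Longrightarrow> finite (small_subsets X r)"
  by (simp add: small_subsets_def)

lemma empty_in_small_subsets: "{} \<in> small_subsets X r"
  by (simp add: small_subsets_def)

lemma card_small_subsets_pos: "finite X \<Longrightarrow> 0 < card (small_subsets X r)"
  using empty_in_small_subsets by (auto simp: card_gt_0_iff finite_small_subsets)

lemma card_small_subsets_le:
  fixes q :: real
  assumes "finite X" "1 \<le> q"
  shows "real (card (small_subsets X r)) \<le> exp (real (card X) / q) * q ^ r"
proof -
  have "real (card (small_subsets X r)) = (\<Sum>C\<in>small_subsets X r. 1)"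
    by simp
  also have "\<dots> \<le> (\<Sum>C\<in>small_subsets X r. q ^ r * (1 / q) ^ card C)"
  proof (intro sum_mono)
    fix C assume "C \<in> small_subsets X r"
    then have "q ^ card C \<le> q ^ r"
      using assms(2) by (intro power_increasing) (auto simp: small_subsets_def)
    then show "1 \<le> q ^ r * (1 / q) ^ card C"
      using assms(2) by (simp add: power_divide field_simps)
  qed
  also have "\<dots> \<le> (\<Sum>C\<in>Pow X. q ^ r * (1 / q) ^ card C)"
    using assms by (intro sum_mono2) (auto simp: small_subsets_def)
  also have "\<dots> = q ^ r * (\<Sum>C\<in>Pow X. (1 / q) ^ card C)"
    by (simp add: sum_distrib_left)
  also have "(\<Sum>C\<in>Pow X. (1 / q) ^ card C) = (1 + 1 / q) ^ card X"
    using prod_add[of X "\<lambda>_. 1 / q" "\<lambda>_. 1"] assms(1) by (simp add: add.commute)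
  also have "(1 + 1 / q) ^ card X \<le> exp (1 / q) ^ card X"
    using assms(2) by (intro power_mono exp_ge_add_one_self) auto
  also have "exp (1 / q) ^ card X = exp (real (card X) / q)"
    by (simp flip: exp_of_nat_mult)
  finally show ?thesis
    using assms(2) by (simp add: mult.commute mult_left_mono)
qed

lemma ln_card_small_subsets_le:
  fixes q :: real
  assumes "finite X" "1 \<le> q"
  shows "ln (real (card (small_subsets X r))) \<le> real (card X) / q + real r * ln q"
proof -
  have "ln (real (card (small_subsets X r))) \<le> ln (exp (real (card X) / q) * q ^ r)"
    using card_small_subsets_le[OF assms] card_small_subsets_pos[OF assms(1)]
    by (intro ln_mono) auto
  then show ?thesis
    using assms(2) by (simp add: ln_mult ln_realpow)
qed

lemma power_le_fact_mult_exp: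
  fixes x :: real
  assumes "0 \<le> x"
  shows "x ^ n \<le> fact n * exp x"
proof -
  have "(\<Sum>i\<in>{n}. x ^ i /\<^sub>R fact i) \<le> (\<Sum>i. x ^ i /\<^sub>R fact i)"
    using assms summable_exp[of x] by (intro sum_le_suminf) auto
  then show ?thesis
    by (simp add: exp_def field_simps)
qed

lemma half_le_ln_2: "1 / 2 \<le> ln (2 :: real)"
  using ln_le_minus_one[of "1 / 2 :: real"] by (simp add: ln_div)

lemma exponent_le_if_power_2_le:
  fixes k :: nat
  assumes "2 ^ u \<le> k * 2 ^ r"
  shows "real u \<le> 2 * ln (real k) + real r"
proof -
  have k_ge_one: "1 \<le> real k"
    using assms by (cases k) auto
  have "2 ^ u \<le> real k * 2 ^ r"
    using assms by (metis (mono_tags) of_nat_le_iff of_nat_mult of_nat_numeral of_nat_power)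
  then have "ln (2 ^ u) \<le> ln (real k * 2 ^ r)"
    by (intro ln_mono) auto
  then have "(real u - real r) * ln 2 \<le> ln (real k)"
    using k_ge_one by (simp add: ln_mult ln_realpow algebra_simps)
  then have "real u - real r \<le> ln (real k) / ln 2"
    by (simp add: pos_le_divide_eq)
  also have "\<dots> \<le> ln (real k) / (1 / 2)"
    using half_le_ln_2 k_ge_one by (intro divide_left_mono) auto
  finally show ?thesis
    by simp
qed

lemma prod_le_power_mult_exp:
  fixes y :: real
  assumes "finite J" "0 < y" "\<And>x. x \<in> J \<Longrightarrow> 0 \<le> f x"
  shows "(\<Prod>x\<in>J. f x) \<le> y ^ card J * exp ((\<Sum>x\<in>J. f x) / y - real (card J))"
proof -
  have "(\<Prod>x\<in>J. f x) \<le> (\<Prod>x\<in>J. y * exp (f x / y - 1))"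
  proof (intro prod_mono conjI assms(3))
    fix x
    have "f x / y \<le> exp (f x / y - 1)"
      using exp_ge_add_one_self[of "f x / y - 1"] by simp
    then show "f x \<le> y * exp (f x / y - 1)"
      using assms(2) by (simp add: field_simps)
  qed
  also have "\<dots> = y ^ card J * exp ((\<Sum>x\<in>J. f x) / y - real (card J))"
    using assms(1) by (simp add: prod.distrib sum_subtractf sum_divide_distrib flip: exp_sum)
  finally show ?thesis .
qed

lemma card_functions_le_graph:
  fixes y :: real
  assumes "finite J" "finite G" "P \<subseteq> extensional J" "0 < y"
    and graph: "\<And>p x. p \<in> P \<Longrightarrow> x \<in> J \<Longrightarrow> (x, p x) \<in> G"
  shows "real (card P) \<le> y ^ card J * exp (real (card G) / y - real (card J))"
proof -
  let ?N = "\<lambda>x. G `` {x}"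
  have finite_values: "finite (?N x)" for x
    using assms(2) by (intro finite_Image) auto
  have sum_card_le: "(\<Sum>x\<in>J. real (card (?N x))) \<le> real (card G)"
  proof -
    have "(\<Sum>x\<in>J. card (?N x)) = card (Sigma J ?N)"
      using assms(1) finite_values by simp
    also have "\<dots> \<le> card G"
      using assms(2) by (intro card_mono) auto
    finally show ?thesis
      by (simp flip: of_nat_sum)
  qed
  have "P \<subseteq> Pi\<^sub>E J ?N"
    using assms(3) graph by (auto simp: PiE_def)
  then have "card P \<le> (\<Prod>x\<in>J. card (?N x))"
    using card_mono[OF finite_PiE[OF assms(1) finite_values]] assms(1) by (simp add: card_PiE)
  then have "real (card P) \<le> (\<Prod>x\<in>J. real (card (?N x)))"
    by (simp flip: of_nat_prod)
  also have "\<dots> \<le> y ^ card J * exp ((\<Sum>x\<in>J. real (card (?N x))) / y - real (card J))"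
    using assms(1,4) by (intro prod_le_power_mult_exp) auto
  also have "\<dots> \<le> y ^ card J * exp (real (card G) / y - real (card J))"
    using sum_card_le assms(4) by (simp add: divide_right_mono)
  finally show ?thesis .
qed

lemma card_family_common_trace_le:
  assumes "finite X" "U \<subseteq> X" "F \<subseteq> Pow X" "\<And>D. D \<in> F \<Longrightarrow> D \<inter> U = E"
  shows "card F * 2 ^ card U \<le> 2 ^ card X"
proof -
  have "inj_on (\<lambda>D. D - U) F"
    using assms(4) by (intro inj_onI) blast
  moreover have "(\<lambda>D. D - U) ` F \<subseteq> Pow (X - U)"
    using assms(3) by auto
  ultimately have "card F \<le> card (Pow (X - U))"
    using assms(1) by (intro card_inj_on_le) auto
  also have "\<dots> = 2 ^ (card X - card U)"
    using assms(1,2) by (simp add: card_Pow card_Diff_subset finite_subset)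
  finally have "card F * 2 ^ card U \<le> 2 ^ (card X - card U) * 2 ^ card U"
    by simp
  also have "\<dots> = 2 ^ card X"
    using card_mono[OF assms(1,2)] by (simp flip: power_add)
  finally show ?thesis .
qed

subsection \<open>Popular sets of cells\<close>

definition snapshots :: "nat set \<Rightarrow> nat \<Rightarrow> nat \<Rightarrow> (nat set \<times> mem) set" where
  "snapshots X r w = (SIGMA C:small_subsets X r. C \<rightarrow>\<^sub>E {..<2 ^ w})"

definition snapshot :: "nat \<Rightarrow> mem \<Rightarrow> nat set \<Rightarrow> nat set \<times> mem" where
  "snapshot w m C = (C, \<lambda>i\<in>C. m i mod 2 ^ w)"

lemma snapshot_in_snapshots: "C \<in> small_subsets X r \<Longrightarrow> snapshot w m C \<in> snapshots X r w"
  by (simp add: snapshot_def snapshots_def)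

lemma snapshot_eqD:
  assumes "snapshot w m C = snapshot w m' C'"
  shows "C = C'" "i \<in> C \<Longrightarrow> m i mod 2 ^ w = m' i mod 2 ^ w"
proof -
  show "C = C'"
    using assms by (simp add: snapshot_def)
  with assms have "(\<lambda>i\<in>C. m i mod 2 ^ w) i = (\<lambda>i\<in>C. m' i mod 2 ^ w) i"
    by (simp add: snapshot_def)
  then show "i \<in> C \<Longrightarrow> m i mod 2 ^ w = m' i mod 2 ^ w"
    by simp
qed

lemma
  assumes "finite X"
  shows finite_snapshots: "finite (snapshots X r w)"
    and card_snapshots_le: "card (snapshots X r w) \<le> card (small_subsets X r) * 2 ^ (w * r)"
proof -
  have finite_subsets: "finite (small_subsets X r)" "\<And>C. C \<in> small_subsets X r \<Longrightarrow> finite C"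
    using assms finite_subset by (auto simp: small_subsets_def)
  then show "finite (snapshots X r w)"
    unfolding snapshots_def by (intro finite_SigmaI finite_PiE) auto
  have "card (snapshots X r w) = (\<Sum>C\<in>small_subsets X r. (2 ^ w) ^ card C)"
    unfolding snapshots_def using finite_subsets
    by (subst card_SigmaI) (auto intro!: finite_PiE simp: card_PiE)
  also have "\<dots> \<le> (\<Sum>C\<in>small_subsets X r. (2 ^ w) ^ r)"
    by (intro sum_mono power_increasing) (auto simp: small_subsets_def)
  finally show "card (snapshots X r w) \<le> card (small_subsets X r) * 2 ^ (w * r)"
    by (simp add: power_mult)
qed

lemma popular_cells:
  fixes M :: "'d \<Rightarrow> mem" and cells :: "'d \<Rightarrow> 'p \<Rightarrow> nat set"
  assumes "finite \<D>" "\<D> \<noteq> {}" "finite R" "finite X"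
    and cells: "\<forall>D\<in>\<D>. \<forall>p\<in>R. cells D p \<in> small_subsets X r"
  obtains D0 F P where "D0 \<in> F" "F \<subseteq> \<D>" "P \<subseteq> R"
    "card R \<le> card P * card (small_subsets X r)"
    "card \<D> \<le> card F * (card (small_subsets X r) * 2 ^ (w * r))"
    "\<And>D p i. D \<in> F \<Longrightarrow> p \<in> P \<Longrightarrow> i \<in> cells D0 p \<Longrightarrow> M D i mod 2 ^ w = M D0 i mod 2 ^ w"
proof -
  let ?\<C> = "small_subsets X r"
  have "\<exists>C\<in>?\<C>. card R \<le> card (cells D -` {C} \<inter> R) * card ?\<C>" if "D \<in> \<D>" for D
    using cells that assms(3,4) empty_in_small_subsets[of X r]
    by (intro pigeonhole_card) (auto simp: finite_small_subsets)
  then obtain popular where popular: "\<And>D. D \<in> \<D> \<Longrightarrow> popular D \<in> ?\<C>"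
    "\<And>D. D \<in> \<D> \<Longrightarrow> card R \<le> card (cells D -` {popular D} \<inter> R) * card ?\<C>"
    by metis
  define view where "view D = snapshot w (M D) (popular D)" for D
  have "view \<in> \<D> \<rightarrow> snapshots X r w"
    by (intro funcsetI) (simp add: view_def snapshot_in_snapshots popular(1))
  then obtain v where large_fibre: "card \<D> \<le> card (view -` {v} \<inter> \<D>) * card (snapshots X r w)"
    using pigeonhole_card[of view \<D> "snapshots X r w"] finite_snapshots[OF assms(4)] assms(1,2)
    by blast
  define F where "F = view -` {v} \<inter> \<D>"
  note large_fibre
  also have "card (view -` {v} \<inter> \<D>) * card (snapshots X r w) \<le> card F * (card ?\<C> * 2 ^ (w * r))"
    unfolding F_def by (intro mult_left_mono card_snapshots_le assms(4)) simp
  finally have card_F: "card \<D> \<le> card F * (card ?\<C> * 2 ^ (w * r))" .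
  moreover have "0 < card \<D>"
    using assms(1,2) by (simp add: card_gt_0_iff)
  ultimately obtain D0 where D0_in_F: "D0 \<in> F"
    by (metis card.empty ex_in_conv mult_zero_left not_le)
  have "M D i mod 2 ^ w = M D0 i mod 2 ^ w"
    if "D \<in> F" "p \<in> cells D0 -` {popular D0} \<inter> R" "i \<in> cells D0 p" for D p i
    using snapshot_eqD[of w "M D" "popular D" "M D0" "popular D0"] that D0_in_F
    by (simp add: F_def view_def)
  then show thesis
    using D0_in_F card_F popular(2)[of D0] by (intro that[of D0 F]) (auto simp: F_def)
qed

subsection \<open>Routing in butterflies\<close>

type_synonym switch = "nat \<times> nat \<times> nat list"
type_synonym slot = "(switch \<times> nat) \<times> nat"
type_synonym routing = "switch \<Rightarrow> nat \<Rightarrow> nat"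

text \<open>Each level of the \<open>A\<close> butterflies consists of the words of \<open>d\<close> digits below \<open>2 * b\<close>. An edge
  of level \<open>k\<close> replaces digit \<open>k\<close>, and the other digits name its switch. A digit \<open>q\<close> stands for the
  pair \<open>(q div 2, q mod 2)\<close>. For each switch and all \<open>i, j < b\<close> the data \<open>D\<close> select one of the two
  perfect matchings between the digits over \<open>i\<close> and the digits over \<open>j\<close>, and the edges of the other
  matching are closed. Hence every routing, that is, every choice of a permutation of \<open>{..<b}\<close> for
  each switch, can be followed along open edges, whatever \<open>D\<close> is.\<close>

locale butterfly =
  fixes A d b :: nat
begin

definition nodes :: "nat list set" where
  "nodes = {z. set z \<subseteq> {..<2 * b} \<and> length z = d}"

definition switches :: "switch set" where
  "switches = {..<A} \<times> {..<d} \<times> {g. set g \<subseteq> {..<2 * b} \<and> length g = d - 1}"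

definition wires :: "(switch \<times> nat) set" where
  "wires = switches \<times> {..<b}"

definition slots :: "slot set" where
  "slots = wires \<times> {..<b}"

definition routings :: "routing set" where
  "routings = (\<Pi>\<^sub>E \<iota>\<in>switches. {\<pi>. \<pi> permutes {..<b}})"

definition num_queries :: nat where
  "num_queries = card ({..<A} \<times> nodes)"

definition switch_at :: "nat \<Rightarrow> nat \<Rightarrow> nat list \<Rightarrow> switch" where
  "switch_at a k z = (a, k, take k z @ drop (Suc k) z)"

definition edge_open :: "slot set \<Rightarrow> nat \<Rightarrow> nat \<Rightarrow> nat list \<Rightarrow> nat \<Rightarrow> bool" where
  "edge_open D a k z q \<longleftrightarrow> odd (z ! k + q) = (((switch_at a k z, z ! k div 2), q div 2) \<in> D)"

definition path_node :: "nat list \<Rightarrow> nat list \<Rightarrow> nat \<Rightarrow> nat list" where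
  "path_node x y k = take k y @ drop k x"

definition path_open :: "slot set \<Rightarrow> nat \<Rightarrow> nat list \<Rightarrow> nat list \<Rightarrow> bool" where
  "path_open D a x y \<longleftrightarrow> (\<forall>k<d. edge_open D a k (path_node x y k) (y ! k))"

definition next_digit :: "slot set \<Rightarrow> routing \<Rightarrow> nat \<Rightarrow> nat \<Rightarrow> nat list \<Rightarrow> nat" where
  "next_digit D p a k z =
    (let \<iota> = switch_at a k z; i = z ! k div 2; j = p \<iota> i
     in 2 * j + (z ! k + of_bool (((\<iota>, i), j) \<in> D)) mod 2)"

definition cross :: "slot set \<Rightarrow> routing \<Rightarrow> nat \<Rightarrow> nat \<Rightarrow> nat list \<Rightarrow> nat list" where
  "cross D p a k z = z[k := next_digit D p a k z]"

primrec route :: "slot set \<Rightarrow> routing \<Rightarrow> nat \<Rightarrow> nat list \<Rightarrow> nat \<Rightarrow> nat list" where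
  "route D p a x 0 = x"
| "route D p a x (Suc k) = cross D p a k (route D p a x k)"

definition sink :: "slot set \<Rightarrow> routing \<Rightarrow> nat \<Rightarrow> nat list \<Rightarrow> nat list" where
  "sink D p a x = route D p a x d"

definition graph :: "routing \<Rightarrow> slot set" where
  "graph p = (\<lambda>(\<iota>, i). ((\<iota>, i), p \<iota> i)) ` wires"

lemma graph_iff: "((\<iota>, i), j) \<in> graph p \<longleftrightarrow> (\<iota>, i) \<in> wires \<and> j = p \<iota> i"
  by (auto simp: graph_def)

lemma finite_nodes: "finite nodes" and card_nodes: "card nodes = (2 * b) ^ d"
  unfolding nodes_def by (simp_all add: finite_lists_length_eq card_lists_length_eq)

lemma num_queries_eq: "num_queries = A * (2 * b) ^ d"
  by (simp only: num_queries_def card_cartesian_product card_nodes card_lessThan)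

lemma length_node: "z \<in> nodes \<Longrightarrow> length z = d"
  by (simp add: nodes_def)

lemma digit_less: "z \<in> nodes \<Longrightarrow> k < d \<Longrightarrow> z ! k < 2 * b"
  unfolding nodes_def by (simp, metis lessThan_iff nth_mem subsetD)

lemma path_node_in_nodes: "x \<in> nodes \<Longrightarrow> y \<in> nodes \<Longrightarrow> path_node x y k \<in> nodes"
  using set_take_subset[of k y] set_drop_subset[of k x] by (auto simp: path_node_def nodes_def)

lemma finite_switches: "finite switches"
  unfolding switches_def by (auto simp: finite_lists_length_eq)

lemma card_switches: "card switches = A * d * (2 * b) ^ (d - 1)"
  unfolding switches_def by (simp add: card_cartesian_product card_lists_length_eq)

lemma finite_wires: "finite wires"
  by (simp add: wires_def finite_switches)

lemma card_wires:
  assumes "0 < d"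
  shows "2 * card wires = d * num_queries"
proof -
  have "2 * card wires = d * (A * ((2 * b) ^ (d - 1) * (2 * b)))"
    by (simp only: wires_def card_cartesian_product card_switches card_lessThan mult_ac)
  then show ?thesis
    using assms by (simp only: power_minus_mult num_queries_eq)
qed

lemma finite_slots: "finite slots"
  by (simp add: slots_def finite_wires)

lemma finite_routings: "finite routings"
  unfolding routings_def by (intro finite_PiE finite_switches finite_permutations) auto

lemma card_routings: "card routings = fact b ^ card switches"
  unfolding routings_def by (simp add: card_PiE finite_switches card_permutations[of _ b])

lemma routing_permutes: "p \<in> routings \<Longrightarrow> \<iota> \<in> switches \<Longrightarrow> p \<iota> permutes {..<b}"
  using PiE_mem[of p switches "\<lambda>_. {\<pi>. \<pi> permutes {..<b}}" \<iota>] by (simp add: routings_def)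

lemma switch_at_in_switches:
  assumes "a < A" "k < d" "z \<in> nodes"
  shows "switch_at a k z \<in> switches"
  using assms set_take_subset[of k z] set_drop_subset[of "Suc k" z]
  by (auto simp: switch_at_def switches_def nodes_def)

lemma node_eqI:
  assumes "z \<in> nodes" "z' \<in> nodes" "k < d" "switch_at a k z = switch_at a k z'" "z ! k = z' ! k"
  shows "z = z'"
proof -
  have "take k z = take k z'" "drop (Suc k) z = drop (Suc k) z'"
    using assms by (auto simp: switch_at_def length_node append_eq_append_conv)
  then show ?thesis
    using assms id_take_nth_drop[of k z] id_take_nth_drop[of k z'] by (simp add: length_node)
qed

lemma ex_node_at_wire:
  assumes "(\<iota>, i) \<in> wires"
  obtains a k z where "a < A" "k < d" "z \<in> nodes" "\<iota> = switch_at a k z" "z ! k div 2 = i"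
proof -
  obtain a k g where switch: "\<iota> = (a, k, g)" "a < A" "k < d" "set g \<subseteq> {..<2 * b}" "length g = d - 1"
    and pair: "i < b"
    using assms by (auto simp: wires_def switches_def)
  define z where "z = take k g @ (2 * i) # drop k g"
  have "z \<in> nodes"
    using switch pair set_take_subset[of k g] set_drop_subset[of k g]
    by (auto simp: z_def nodes_def)
  moreover have "\<iota> = switch_at a k z" "z ! k div 2 = i"
    using switch by (simp_all add: z_def switch_at_def nth_append)
  ultimately show thesis
    using switch that by blast
qed

subsection \<open>Routes along open edges\<close>

lemma next_digit_div_2: "next_digit D p a k z div 2 = p (switch_at a k z) (z ! k div 2)"
  by (simp add: next_digit_def Let_def)

lemma edge_open_next_digit: "edge_open D a k z (next_digit D p a k z)"
  unfolding edge_open_def next_digit_div_2 by (auto simp: next_digit_def Let_def)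

lemma next_digit_less:
  assumes "p \<in> routings" "a < A" "k < d" "z \<in> nodes"
  shows "next_digit D p a k z < 2 * b"
proof -
  have "z ! k div 2 \<in> {..<b}"
    using digit_less[OF assms(4,3)] by auto
  then have "next_digit D p a k z div 2 < b"
    using permutes_in_image[OF routing_permutes[OF assms(1) switch_at_in_switches[OF assms(2-4)]]]
    by (simp add: next_digit_div_2)
  then show ?thesis
    by linarith
qed

lemma cross_in_nodes:
  assumes "p \<in> routings" "a < A" "k < d" "z \<in> nodes"
  shows "cross D p a k z \<in> nodes"
  using assms(4) next_digit_less[OF assms, of D] set_update_subset_insert[of z k]
  by (fastforce simp: cross_def nodes_def)

lemma switch_at_cross: "switch_at a k (cross D p a k z) = switch_at a k z"
  by (simp add: cross_def switch_at_def)

lemma inj_on_cross: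
  assumes "p \<in> routings" "a < A" "k < d"
  shows "inj_on (cross D p a k) nodes"
proof (rule inj_onI)
  fix z z' assume nodes: "z \<in> nodes" "z' \<in> nodes" and cross_eq: "cross D p a k z = cross D p a k z'"
  have switch: "switch_at a k z = switch_at a k z'"
    using switch_at_cross[of a k D p z] switch_at_cross[of a k D p z'] cross_eq by simp
  have digit: "next_digit D p a k z = next_digit D p a k z'"
    using arg_cong[OF cross_eq, of "\<lambda>u. u ! k"] nodes assms(3) by (simp add: cross_def length_node)
  have "p (switch_at a k z) (z ! k div 2) = p (switch_at a k z) (z' ! k div 2)"
    using next_digit_div_2[of D p a k] digit switch by metis
  moreover have "inj (p (switch_at a k z))"
    using routing_permutes[OF assms(1) switch_at_in_switches[OF assms(2,3) nodes(1)]] permutes_inj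
    by blast
  ultimately have pair: "z ! k div 2 = z' ! k div 2"
    by (meson injD)
  have "edge_open D a k z (next_digit D p a k z)" "edge_open D a k z' (next_digit D p a k z)"
    using edge_open_next_digit digit by metis+
  then have "even (z ! k) \<longleftrightarrow> even (z' ! k)"
    using pair switch by (auto simp: edge_open_def)
  with pair have "z ! k = z' ! k"
    by (metis div_mult_mod_eq parity_cases)
  with switch show "z = z'"
    using node_eqI nodes assms(3) by blast
qed

lemma route_image_nodes:
  assumes "p \<in> routings" "a < A" "k \<le> d"
  shows "(\<lambda>x. route D p a x k) ` nodes = nodes"
  using assms(3)
proof (induction k)
  case (Suc k)
  have "(\<lambda>x. route D p a x (Suc k)) ` nodes = cross D p a k ` (\<lambda>x. route D p a x k) ` nodes"
    by (auto simp: image_image)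
  also have "\<dots> = cross D p a k ` nodes"
    using Suc by simp
  also have "\<dots> = nodes"
    using Suc.prems assms
    by (intro endo_inj_surj finite_nodes inj_on_cross) (auto intro: cross_in_nodes)
  finally show ?case .
qed auto

lemma sink_in_nodes: "p \<in> routings \<Longrightarrow> a < A \<Longrightarrow> x \<in> nodes \<Longrightarrow> sink D p a x \<in> nodes"
  using route_image_nodes[of p a d D] by (auto simp: sink_def)

lemma length_route [simp]: "length (route D p a x k) = length x"
  by (induction k) (simp_all add: cross_def)

lemma drop_route: "drop k (route D p a x k) = drop k x"
proof (induction k)
  case (Suc k)
  have "drop (Suc k) (route D p a x (Suc k)) = drop 1 (drop k (route D p a x k))"
    by (simp add: cross_def)
  then show ?case
    by (simp add: Suc)
qed simp

lemma take_route: "k \<le> l \<Longrightarrow> take k (route D p a x l) = take k (route D p a x k)"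
  by (induction l rule: dec_induct) (simp_all add: cross_def)

lemma route_eq_path_node: "k \<le> d \<Longrightarrow> route D p a x k = path_node x (sink D p a x) k"
  unfolding path_node_def sink_def take_route by (metis append_take_drop_id drop_route)

lemma sink_nth:
  assumes "x \<in> nodes" "k < d"
  shows "sink D p a x ! k = next_digit D p a k (route D p a x k)"
proof -
  have "sink D p a x ! k = path_node x (sink D p a x) (Suc k) ! k"
    using assms by (simp add: path_node_def nth_append sink_def length_node)
  also have "\<dots> = route D p a x (Suc k) ! k"
    using assms(2) by (simp only: route_eq_path_node Suc_le_eq)
  also have "\<dots> = next_digit D p a k (route D p a x k)"
    using assms by (simp add: cross_def length_node)
  finally show ?thesis .
qed

lemma path_open_sink: "x \<in> nodes \<Longrightarrow> path_open D a x (sink D p a x)"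
  by (simp add: path_open_def sink_nth edge_open_next_digit flip: route_eq_path_node)

text \<open>The routes pass through every node of every level, so openness of all of them pins the data
  down on the whole graph of the routing.\<close>
lemma graph_agree_if_sinks_open:
  assumes "p \<in> routings"
    and sinks_open: "\<And>a x. a < A \<Longrightarrow> x \<in> nodes \<Longrightarrow> path_open D' a x (sink D p a x)"
  shows "D' \<inter> graph p = D \<inter> graph p"
proof -
  have "((\<iota>, i), p \<iota> i) \<in> D' \<longleftrightarrow> ((\<iota>, i), p \<iota> i) \<in> D" if "(\<iota>, i) \<in> wires" for \<iota> i
  proof -
    obtain a k z where wire: "a < A" "k < d" "z \<in> nodes" "\<iota> = switch_at a k z" "z ! k div 2 = i"
      using \<open>(\<iota>, i) \<in> wires\<close> by (rule ex_node_at_wire)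
    then obtain x where source: "x \<in> nodes" "z = route D p a x k"
      using route_image_nodes[OF assms(1), of a k D] by auto
    have digit: "sink D p a x ! k = next_digit D p a k z"
      using source wire(2) by (simp add: sink_nth)
    have slot: "odd (z ! k + next_digit D p a k z) \<longleftrightarrow> ((\<iota>, i), p \<iota> i) \<in> E"
      if "path_open E a x (sink D p a x)" for E
      using that wire source(2) digit next_digit_div_2[of D p a k z]
      by (auto simp: path_open_def edge_open_def simp flip: route_eq_path_node)
    show ?thesis
      using slot[OF path_open_sink[OF source(1)]] slot[OF sinks_open[OF wire(1) source(1)]] by simp
  qed
  then show ?thesis
    by (auto simp: graph_def)
qed

subsection \<open>Graphs of routings\<close>

lemma graph_subset_slots: "p \<in> routings \<Longrightarrow> graph p \<subseteq> slots"
  using permutes_in_image[OF routing_permutes]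
  by (fastforce simp: graph_def slots_def wires_def)

lemma inj_on_uncurry_routings: "inj_on (\<lambda>p. \<lambda>(\<iota>, i)\<in>wires. p \<iota> i) routings"
proof (rule inj_onI)
  fix p p' :: routing
  assume routings: "p \<in> routings" "p' \<in> routings"
    and uncurry_eq: "(\<lambda>(\<iota>, i)\<in>wires. p \<iota> i) = (\<lambda>(\<iota>, i)\<in>wires. p' \<iota> i)"
  have "p \<iota> i = p' \<iota> i" if "\<iota> \<in> switches" for \<iota> i
  proof (cases "i < b")
    case True
    then show ?thesis
      using fun_cong[OF uncurry_eq, of "(\<iota>, i)"] that by (simp add: wires_def)
  next
    case False
    then show ?thesis
      using routings[THEN routing_permutes, OF that] by (metis lessThan_iff permutes_not_in)
  qed
  then show "p = p'"
    using routings unfolding routings_def by (intro PiE_ext[of p switches _ p']) auto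
qed

lemma ln_card_routings_le_graphs:
  fixes y :: real
  assumes "P \<subseteq> routings" "P \<noteq> {}" "0 < y"
  shows "ln (real (card P))
    \<le> real (card wires) * ln y + real (card (\<Union> (graph ` P))) / y - real (card wires)"
proof -
  let ?U = "\<Union> (graph ` P)" and ?uncurry = "\<lambda>p. \<lambda>(\<iota>, i)\<in>wires. p \<iota> i"
  have "finite ?U"
    using assms(1) graph_subset_slots finite_slots by (meson UN_least finite_subset subsetD)
  then have "real (card (?uncurry ` P))
      \<le> y ^ card wires * exp (real (card ?U) / y - real (card wires))"
    using assms by (intro card_functions_le_graph finite_wires) (auto simp: graph_iff)
  moreover have "card (?uncurry ` P) = card P"
    using inj_on_subset[OF inj_on_uncurry_routings assms(1)] by (rule card_image)
  moreover have "0 < card P"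
    using assms(1,2) finite_routings finite_subset by (auto simp: card_gt_0_iff)
  ultimately have "ln (real (card P))
      \<le> ln (y ^ card wires * exp (real (card ?U) / y - real (card wires)))"
    by (intro ln_mono) auto
  then show ?thesis
    using assms(3) by (simp add: ln_mult ln_realpow)
qed

lemma ln_card_routings_ge:
  assumes "0 < b"
  shows "real (card wires) * ln (real b) - real (card wires) \<le> ln (real (card routings))"
proof -
  have "real b ^ card wires = (real b ^ b) ^ card switches"
    by (simp add: wires_def card_cartesian_product power_mult mult.commute)
  also have "\<dots> \<le> (fact b * exp (real b)) ^ card switches"
    by (intro power_mono power_le_fact_mult_exp) auto
  also have "\<dots> = real (card routings) * exp (real (card wires))"
    by (simp add: card_routings wires_def card_cartesian_product power_mult_distrib
        flip: exp_of_nat_mult)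
  finally have "ln (real b ^ card wires) \<le> ln (real (card routings) * exp (real (card wires)))"
    using assms by (intro ln_mono) auto
  then show ?thesis
    using assms by (simp add: ln_mult ln_realpow card_routings)
qed

end

subsection \<open>The probe bound for butterfly reachability\<close>

locale reachability_structure = butterfly A d b for A d b :: nat +
  fixes s w t :: nat
    and M :: "slot set \<Rightarrow> mem"
    and query :: "nat \<Rightarrow> nat list \<Rightarrow> nat list \<Rightarrow> 'r probe_tree"
    and decode :: "'r \<Rightarrow> bool"
  assumes cells_pos: "0 < s"
    and cost_query_le: "\<And>D a x y. D \<subseteq> slots \<Longrightarrow> a < A \<Longrightarrow> x \<in> nodes \<Longrightarrow> y \<in> nodes \<Longrightarrow>
      cost s w (query a x y) (M D) \<le> t"
    and decode_answer_iff: "\<And>D a x y. D \<subseteq> slots \<Longrightarrow> a < A \<Longrightarrow> x \<in> nodes \<Longrightarrow> y \<in> nodes \<Longrightarrow>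
      decode (answer s w (query a x y) (M D)) \<longleftrightarrow> path_open D a x y"
begin

definition route_probes :: "slot set \<Rightarrow> routing \<Rightarrow> nat set" where
  "route_probes D p =
    (\<Union>(a, x)\<in>{..<A} \<times> nodes. probes s w (query a x (sink D p a x)) (M D))"

definition probe_sets :: "nat set set" where
  "probe_sets = small_subsets {..<s} (num_queries * t)"

lemma route_probes_in_probe_sets:
  assumes "D \<subseteq> slots" "p \<in> routings"
  shows "route_probes D p \<in> probe_sets"
proof -
  let ?probes = "\<lambda>(a, x). probes s w (query a x (sink D p a x)) (M D)"
  have "card (route_probes D p) \<le> (\<Sum>ax\<in>{..<A} \<times> nodes. card (?probes ax))"
    unfolding route_probes_def by (intro card_UN_le) (simp add: finite_nodes)
  also have "\<dots> \<le> of_nat num_queries * t"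
    unfolding num_queries_def
  proof (intro sum_bounded_above)
    fix ax assume "ax \<in> {..<A} \<times> nodes"
    then obtain a x where query: "ax = (a, x)" "a < A" "x \<in> nodes"
      by auto
    then have "cost s w (query a x (sink D p a x)) (M D) \<le> t"
      using assms by (intro cost_query_le sink_in_nodes)
    then show "card (?probes ax) \<le> t"
      unfolding query prod.case using card_probes_le_cost order_trans by blast
  qed
  finally show ?thesis
    using probes_subset_lessThan[OF cells_pos]
    by (auto simp: probe_sets_def small_subsets_def route_probes_def)
qed

lemma graph_agree_if_route_probes_agree:
  assumes "D \<subseteq> slots" "D' \<subseteq> slots" "p \<in> routings"
    and agree: "\<And>i. i \<in> route_probes D p \<Longrightarrow> M D' i mod 2 ^ w = M D i mod 2 ^ w"
  shows "D' \<inter> graph p = D \<inter> graph p"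
proof (rule graph_agree_if_sinks_open[OF assms(3)])
  fix a x assume source: "a < A" "x \<in> nodes"
  let ?q = "query a x (sink D p a x)"
  have sink: "sink D p a x \<in> nodes"
    using assms(3) source by (intro sink_in_nodes)
  have "answer s w ?q (M D') = answer s w ?q (M D)"
    using source by (intro answer_cong_probes agree) (auto simp: route_probes_def)
  moreover have "decode (answer s w ?q (M D))"
    using source sink assms(1) by (simp add: decode_answer_iff path_open_sink)
  ultimately show "path_open D' a x (sink D p a x)"
    using source sink assms(2) by (simp flip: decode_answer_iff)
qed

lemma many_routings_with_small_graphs:
  obtains P where "P \<subseteq> routings" "card routings \<le> card P * card probe_sets"
    "2 ^ card (\<Union> (graph ` P)) \<le> card probe_sets * 2 ^ (w * (num_queries * t))"
proof -
  let ?r = "num_queries * t"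
  have cells: "\<forall>D\<in>Pow slots. \<forall>p\<in>routings. route_probes D p \<in> small_subsets {..<s} ?r"
    using route_probes_in_probe_sets by (simp add: probe_sets_def)
  have "finite (Pow slots)" "Pow slots \<noteq> {}"
    by (auto simp: finite_slots)
  then obtain D0 F P where family: "D0 \<in> F" "F \<subseteq> Pow slots" and P_subset: "P \<subseteq> routings"
    and card_P: "card routings \<le> card P * card probe_sets"
    and card_F: "card (Pow slots) \<le> card F * (card probe_sets * 2 ^ (w * ?r))"
    and agree: "\<And>D p i. D \<in> F \<Longrightarrow> p \<in> P \<Longrightarrow> i \<in> route_probes D0 p \<Longrightarrow>
      M D i mod 2 ^ w = M D0 i mod 2 ^ w"
    by (rule popular_cells[where M = M and w = w and cells = route_probes,
          OF _ _ finite_routings finite_lessThan cells, folded probe_sets_def])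
      (rule that)
  let ?U = "\<Union> (graph ` P)"
  have "D \<inter> graph p = D0 \<inter> graph p" if "D \<in> F" "p \<in> P" for D p
    using that family P_subset by (intro graph_agree_if_route_probes_agree agree) auto
  then have "card F * 2 ^ card ?U \<le> 2 ^ card slots"
    using P_subset family(2) graph_subset_slots
    by (intro card_family_common_trace_le[of _ _ _ "D0 \<inter> ?U"] finite_slots) blast+
  then have "(card probe_sets * 2 ^ (w * ?r)) * (card F * 2 ^ card ?U)
      \<le> (card probe_sets * 2 ^ (w * ?r)) * 2 ^ card slots"
    by (rule mult_left_mono) simp
  moreover have "2 ^ card slots * 2 ^ card ?U
      \<le> (card F * (card probe_sets * 2 ^ (w * ?r))) * 2 ^ card ?U"
    using card_F finite_slots by (intro mult_right_mono) (simp_all add: card_Pow)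
  ultimately have "2 ^ card slots * 2 ^ card ?U \<le> 2 ^ card slots * (card probe_sets * 2 ^ (w * ?r))"
    by (simp only: mult_ac)
  then show thesis
    using that[OF P_subset card_P] by simp
qed

lemma ln_card_probe_sets_le:
  assumes "1 \<le> \<sigma>" "real s \<le> \<sigma> * real num_queries"
  shows "ln (real (card probe_sets)) \<le> real num_queries * (1 + real t * ln \<sigma>)"
proof -
  let ?K = "real num_queries"
  have "ln (real (card probe_sets)) \<le> real s / \<sigma> + ?K * real t * ln \<sigma>"
    using ln_card_small_subsets_le[of "{..<s}" \<sigma> "num_queries * t"] assms(1)
    by (simp add: probe_sets_def)
  also have "real s / \<sigma> \<le> ?K"
    using assms by (simp add: divide_le_eq mult.commute)
  finally show ?thesis
    by (simp add: algebra_simps)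
qed

lemma card_wires_mult_ln_le:
  assumes "0 < b"
  shows "real (card wires) * ln (real b)
    \<le> 6 * ln (real (card probe_sets)) + 2 * real (w * (num_queries * t)) / sqrt (real b)"
proof -
  let ?r = "w * (num_queries * t)" and ?H = "ln (real (card probe_sets))"
  obtain P where P_subset: "P \<subseteq> routings" and card_P: "card routings \<le> card P * card probe_sets"
    and graphs: "2 ^ card (\<Union> (graph ` P)) \<le> card probe_sets * 2 ^ ?r"
    by (rule many_routings_with_small_graphs)
  define U where "U = real (card (\<Union> (graph ` P)))"
  have sets_pos: "1 \<le> real (card probe_sets)" and P_pos: "0 < card P"
    using card_small_subsets_pos[of "{..<s}"] card_P
    by (auto simp: probe_sets_def card_routings Suc_le_eq intro: gr0I)
  then have "P \<noteq> {}"
    by auto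
  have "real (card routings) \<le> real (card P) * real (card probe_sets)"
    using card_P by (metis of_nat_le_iff of_nat_mult)
  then have "ln (real (card routings)) \<le> ln (real (card P) * real (card probe_sets))"
    by (intro ln_mono) (auto simp: card_routings)
  then have "ln (real (card routings)) \<le> ln (real (card P)) + ?H"
    using sets_pos P_pos by (simp add: ln_mult)
  then have "real (card wires) * ln (real b) \<le> 2 * (U / sqrt (real b)) + 2 * ?H"
    using ln_card_routings_ge[OF assms] assms
      ln_card_routings_le_graphs[OF P_subset \<open>P \<noteq> {}\<close>, of "sqrt (real b)"]
    by (simp add: U_def ln_sqrt)
  also have "U / sqrt (real b) \<le> (2 * ?H + real ?r) / sqrt (real b)"
    using exponent_le_if_power_2_le[OF graphs] by (intro divide_right_mono) (simp_all add: U_def)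
  also have "\<dots> \<le> 2 * ?H + real ?r / sqrt (real b)"
    using assms sets_pos mult_left_mono[of 1 "sqrt (real b)" ?H]
    by (simp add: add_divide_distrib divide_le_eq)
  finally show ?thesis
    by simp
qed

theorem probe_bound:
  fixes \<sigma> :: real
  assumes "0 < A" "0 < b" "0 < d" "1 \<le> \<sigma>" "real s \<le> \<sigma> * real num_queries"
  shows "real d * ln (real b) \<le> 12 + 12 * real t * ln \<sigma> + 4 * real t * real w / sqrt (real b)"
proof -
  define K where "K = real num_queries"
  have "2 * real (card wires) = real d * K"
    using arg_cong[OF card_wires[OF assms(3)], of real] by (simp add: K_def)
  then have "K * (real d * ln (real b)) = 2 * (real (card wires) * ln (real b))"
    by (simp add: K_def)
  also have "\<dots> \<le> 2 * (6 * (K * (1 + real t * ln \<sigma>)) + 2 * (real w * (K * real t)) / sqrt (real b))"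
    using card_wires_mult_ln_le[OF assms(2)] ln_card_probe_sets_le[OF assms(4,5)]
    by (simp add: K_def)
  also have "\<dots> = K * (12 + 12 * real t * ln \<sigma> + 4 * real t * real w / sqrt (real b))"
    by (simp add: field_simps)
  finally show ?thesis
    using assms(1,2) by (simp add: K_def num_queries_eq)
qed

end

subsection \<open>Longest common substrings\<close>

lemma length_concat_map_const:
  "(\<And>x. x \<in> set xs \<Longrightarrow> length (f x) = l) \<Longrightarrow> length (concat (map f xs)) = length xs * l"
  by (induction xs) auto

lemma length_n_lists: "length (List.n_lists k xs) = length xs ^ k"
  by (induction k) (simp_all add: length_concat_map_const[of _ _ "length xs"])

lemma sublist_concat_terminated_iff:
  assumes "v \<noteq> []" "h \<notin> set v"
  shows "sublist v (concat (map (\<lambda>e. e @ [h]) es)) \<longleftrightarrow> (\<exists>e\<in>set es. sublist v e)"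
proof (induction es)
  case (Cons e es)
  let ?C = "concat (map (\<lambda>e. e @ [h]) es)"
  have "\<not> prefix v (h # ?C)"
    using assms by (cases v) auto
  moreover have "sublist v e" if "v = v1 @ v2" "suffix v1 e" "prefix v2 (h # ?C)" for v1 v2
    using that assms by (cases v2) (auto intro: suffix_imp_sublist)
  ultimately have "sublist v (e @ h # ?C) \<longleftrightarrow> sublist v e \<or> sublist v ?C"
    unfolding sublist_append sublist_Cons_right by blast
  then show ?case
    by (simp add: Cons)
qed (simp add: assms)

lemma sublist_same_length: "sublist xs ys \<Longrightarrow> length xs = length ys \<Longrightarrow> xs = ys"
  by (auto simp: sublist_def)

lemma common_substring_iff_sublists:
  "(\<exists>i j. common_substring S T (i, j, l)) \<longleftrightarrow> (\<exists>v. sublist v S \<and> sublist v T \<and> length v = l)"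
  (is "?L \<longleftrightarrow> ?R")
proof
  assume ?L
  then obtain i j where in_range: "i + l \<le> length S" "j + l \<le> length T"
    and equal: "take l (drop i S) = take l (drop j T)"
    by (auto simp: common_substring_def)
  have "sublist (take l (drop i S)) S" "sublist (take l (drop j T)) T"
    by (meson sublist_drop sublist_order.order.trans sublist_take)+
  then show ?R
    using in_range equal by (intro exI[of _ "take l (drop i S)"]) simp
next
  assume ?R
  then obtain v p1 p2 t1 t2 where "S = p1 @ v @ p2" "T = t1 @ v @ t2" "length v = l"
    by (auto simp: sublist_def)
  then have "common_substring S T (length p1, length t1, l)"
    by (auto simp: common_substring_def)
  then show ?L
    by blast
qed

lemma lcs_length_ge_iff:
  assumes "is_lcs S T ans"
  shows "l \<le> snd (snd ans) \<longleftrightarrow> (\<exists>v. sublist v S \<and> sublist v T \<and> length v = l)"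
  unfolding common_substring_iff_sublists[symmetric]
proof
  obtain i j l' where ans: "ans = (i, j, l')"
    by (cases ans)
  assume "l \<le> snd (snd ans)"
  then have "common_substring S T (i, j, l)"
    using assms
    by (auto simp: is_lcs_def common_substring_def ans dest: arg_cong[where f = "take l"])
  then show "\<exists>i j. common_substring S T (i, j, l)"
    by blast
next
  show "\<exists>i j. common_substring S T (i, j, l) \<Longrightarrow> l \<le> snd (snd ans)"
    using assms by (auto simp: is_lcs_def)
qed

lemma lcs_ds_first_update:
  assumes "lcs_ds n s w init upd t" "str_n n S" "str_n n T" "j < length S" "a < n"
  shows "is_lcs (S[j := a]) T (answer s w (upd j a) (init S T))"
    and "cost s w (upd j a) (init S T) \<le> t"
proof -
  obtain ans m' c where exec: "exec s w (upd j a) (init S T) = (ans, m', c)"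
    by (rule prod_cases3)
  have "reach n s w init upd T (S, init S T)"
    by (rule reach.start[OF assms(2)])
  then have "is_lcs (S[j := a]) T ans \<and> c \<le> t"
    using assms exec unfolding lcs_ds_def by fastforce
  then show "is_lcs (S[j := a]) T (answer s w (upd j a) (init S T))"
    and "cost s w (upd j a) (init S T) \<le> t"
    by (simp_all add: exec)
qed

subsection \<open>Encoding butterflies in strings\<close>

context butterfly
begin

text \<open>Letters below \<open>2 * b\<close> are digits, and \<open>marker a\<close> names the butterfly \<open>a < A\<close>. The letter
  \<open>marker A\<close> is the placeholder between source and sink in the dynamic string, and
  \<open>marker (Suc A)\<close> terminates the words of the static string.\<close>

abbreviation marker :: "nat \<Rightarrow> nat" where
  "marker a \<equiv> 2 * b + a"

definition filler_letters :: "nat set" where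
  "filler_letters = insert (marker A) {..<2 * b}"

definition edge_word :: "nat \<Rightarrow> nat \<Rightarrow> nat list \<Rightarrow> nat \<Rightarrow> nat list" where
  "edge_word a k z q = drop k z @ [marker a] @ take k z @ [q]"

definition node_list :: "nat list list" where
  "node_list = List.n_lists d [0..<2 * b]"

definition closed_edges :: "slot set \<Rightarrow> (nat \<times> nat \<times> nat list \<times> nat) list" where
  "closed_edges D = filter (\<lambda>(a, k, z, q). \<not> edge_open D a k z q)
    (List.product [0..<A] (List.product [0..<d] (List.product node_list [0..<2 * b])))"

definition closed_words :: "slot set \<Rightarrow> nat list list" where
  "closed_words D = map (\<lambda>(a, k, z, q). edge_word a k z q) (closed_edges D)"

definition static_string :: "slot set \<Rightarrow> nat list" where
  "static_string D = concat (map (\<lambda>v. v @ [marker (Suc A)]) (closed_words D))"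

definition template :: "nat list" where
  "template = concat (map (\<lambda>(x, y). x @ [marker A] @ y) (List.product node_list node_list))"

lemma set_node_list: "set node_list = nodes"
  by (auto simp: node_list_def nodes_def set_n_lists)

lemma length_node_list: "length node_list = (2 * b) ^ d"
  by (simp add: node_list_def length_n_lists)

lemma closed_words_iff:
  "v \<in> set (closed_words D) \<longleftrightarrow> (\<exists>a k z q. a < A \<and> k < d \<and> z \<in> nodes \<and> q < 2 * b \<and>
    \<not> edge_open D a k z q \<and> v = edge_word a k z q)"
  by (auto simp: closed_words_def closed_edges_def set_node_list image_iff Bex_def)

lemma length_edge_word: "z \<in> nodes \<Longrightarrow> k < d \<Longrightarrow> length (edge_word a k z q) = d + 2"
  by (simp add: edge_word_def length_node)

lemma set_edge_word_subset: "z \<in> nodes \<Longrightarrow> set (edge_word a k z q) \<subseteq> {marker a, q} \<union> {..<2 * b}"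
  using set_take_subset[of k z] set_drop_subset[of k z] by (auto simp: edge_word_def nodes_def)

lemma length_closed_word: "v \<in> set (closed_words D) \<Longrightarrow> length v = d + 2"
  by (auto simp: closed_words_iff length_edge_word)

lemma set_closed_word_subset: "v \<in> set (closed_words D) \<Longrightarrow> set v \<subseteq> {..<marker A}"
  using set_edge_word_subset by (fastforce simp: closed_words_iff)

lemma length_static_string_le: "length (static_string D) \<le> A * d * (2 * b) ^ (d + 1) * (d + 3)"
proof -
  have "length (static_string D) = length (closed_words D) * (d + 3)"
    unfolding static_string_def
    by (rule length_concat_map_const) (simp add: length_closed_word)
  moreover have "length (closed_words D) \<le> A * (d * ((2 * b) ^ d * (2 * b)))"
    unfolding closed_words_def closed_edges_def
    by (rule order_trans[OF eq_imp_le[OF length_map] order_trans[OF length_filter_le]])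
      (simp add: length_node_list)
  ultimately show ?thesis
    by (simp add: mult_ac)
qed

lemma set_static_string_subset: "set (static_string D) \<subseteq> {..<marker A + 2}"
proof -
  have "set (static_string D) \<subseteq> insert (marker (Suc A)) (\<Union>v\<in>set (closed_words D). set v)"
    by (auto simp: static_string_def split: if_splits)
  also have "\<dots> \<subseteq> insert (marker (Suc A)) {..<marker A}"
    by (intro insert_mono UN_least set_closed_word_subset)
  also have "\<dots> \<subseteq> {..<marker A + 2}"
    by auto
  finally show ?thesis .
qed

lemma length_template: "length template = ((2 * b) ^ d)\<^sup>2 * (2 * d + 1)"
proof -
  have "length template = length (List.product node_list node_list) * (2 * d + 1)"
    unfolding template_def
    by (rule length_concat_map_const) (auto simp: set_node_list length_node)
  then show ?thesis
    by (simp add: length_node_list power2_eq_square)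
qed

lemma set_template_block_subset:
  "x \<in> nodes \<Longrightarrow> y \<in> nodes \<Longrightarrow> set (x @ [marker A] @ y) \<subseteq> filler_letters"
  by (auto simp: filler_letters_def nodes_def)

lemma set_template_subset: "set template \<subseteq> filler_letters"
  using set_template_block_subset by (fastforce simp: template_def set_node_list)

lemma template_update:
  assumes "x \<in> nodes" "y \<in> nodes"
  shows "\<exists>j pre post. j < length template \<and> set pre \<subseteq> filler_letters \<and> set post \<subseteq> filler_letters \<and>
    (\<forall>l. template[j := l] = pre @ x @ [l] @ y @ post)"
proof -
  obtain qs1 qs2 where "List.product node_list node_list = qs1 @ (x, y) # qs2"
    using assms split_list[of "(x, y)" "List.product node_list node_list"]
    by (auto simp: set_node_list)
  then obtain pre post where template: "template = pre @ x @ [marker A] @ y @ post"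
    unfolding template_def by fastforce
  then have "set pre \<subseteq> filler_letters" "set post \<subseteq> filler_letters"
    using set_template_subset by auto
  then show ?thesis
    using template
    by (intro exI[of _ "length (pre @ x)"] exI[of _ pre] exI[of _ post])
      (simp add: list_update_append)
qed

lemma edge_word_path_node:
  assumes "x \<in> nodes" "y \<in> nodes" "k < d"
  shows "edge_word a k (path_node x y k) (y ! k) = drop k x @ [marker a] @ take (Suc k) y"
  using assms by (simp add: edge_word_def path_node_def length_node take_Suc_conv_app_nth)

lemma sublist_edge_word_path_node:
  assumes "x \<in> nodes" "y \<in> nodes" "k < d"
  shows "sublist (edge_word a k (path_node x y k) (y ! k)) (pre @ x @ [marker a] @ y @ post)"
proof -
  have "pre @ x @ [marker a] @ y @ post
      = (pre @ take k x) @ (drop k x @ [marker a] @ take (Suc k) y) @ drop (Suc k) y @ post"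
    by (metis append_assoc append_take_drop_id)
  then show ?thesis
    using assms by (metis edge_word_path_node sublist_appendI)
qed

text \<open>The marker in the middle synchronizes an edge word with the block that it occurs in.\<close>
lemma sublist_edge_word_iff:
  assumes "x \<in> nodes" "y \<in> nodes" "z \<in> nodes" "a < A" "a' < A" "k < d"
    and "set pre \<subseteq> filler_letters" "set post \<subseteq> filler_letters"
  shows "sublist (edge_word a' k z q) (pre @ x @ [marker a] @ y @ post)
    \<longleftrightarrow> a' = a \<and> z = path_node x y k \<and> q = y ! k" (is "sublist _ ?S \<longleftrightarrow> _")
proof
  assume "sublist (edge_word a' k z q) ?S"
  then obtain p1 p2 where occurrence: "?S = p1 @ edge_word a' k z q @ p2"
    by (auto simp: sublist_def)
  have not_marker: "marker a'' \<notin> set (pre @ x)" "marker a'' \<notin> set (y @ post)" if "a'' < A" for a''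
    using assms that by (auto simp: filler_letters_def nodes_def)
  have "marker a' \<in> set ?S"
    unfolding occurrence by (simp add: edge_word_def)
  then have same_marker: "a' = a"
    using not_marker[OF assms(5)] by auto
  have "(pre @ x) @ marker a # (y @ post) = (p1 @ drop k z) @ marker a # (take k z @ q # p2)"
    using occurrence same_marker by (simp add: edge_word_def)
  then have sides: "pre @ x = p1 @ drop k z" "y @ post = take k z @ q # p2"
    using not_marker[OF assms(4)] by (simp_all only: append_Cons_eq_iff simp_thms)
  have "length p1 = length pre + k"
    using arg_cong[OF sides(1), of length] assms by (simp add: length_node)
  then have "drop k z = drop k x"
    using arg_cong[OF sides(1), of "drop (length p1)"] by simp
  moreover have "take k z = take k y"
    using arg_cong[OF sides(2), of "take k"] assms by (simp add: length_node)
  moreover have "q = y ! k"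
    using arg_cong[OF sides(2), of "\<lambda>u. u ! k"] assms by (simp add: length_node nth_append)
  ultimately show "a' = a \<and> z = path_node x y k \<and> q = y ! k"
    using same_marker by (metis append_take_drop_id path_node_def)
qed (use assms sublist_edge_word_path_node in blast)

lemma path_open_iff_no_closed_word:
  assumes "x \<in> nodes" "y \<in> nodes" "a < A"
    and "set pre \<subseteq> filler_letters" "set post \<subseteq> filler_letters"
  shows "path_open D a x y
    \<longleftrightarrow> \<not> (\<exists>v\<in>set (closed_words D). sublist v (pre @ x @ [marker a] @ y @ post))"
proof -
  have "path_node x y k \<in> nodes" "y ! k < 2 * b" if "k < d" for k
    using assms that by (auto simp: path_node_in_nodes digit_less)
  moreover have "sublist (edge_word a' k z q) (pre @ x @ [marker a] @ y @ post)
      \<longleftrightarrow> a' = a \<and> z = path_node x y k \<and> q = y ! k" if "z \<in> nodes" "a' < A" "k < d" for a' k z q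
    using assms that by (intro sublist_edge_word_iff)
  ultimately have "(\<exists>v\<in>set (closed_words D). sublist v (pre @ x @ [marker a] @ y @ post))
      \<longleftrightarrow> (\<exists>k<d. \<not> edge_open D a k (path_node x y k) (y ! k))"
    unfolding Bex_def closed_words_iff using assms(3) by (metis (no_types, lifting))
  then show ?thesis
    by (simp add: path_open_def)
qed

lemma path_open_iff_lcs_length:
  assumes "x \<in> nodes" "y \<in> nodes" "a < A"
    and "set pre \<subseteq> filler_letters" "set post \<subseteq> filler_letters"
    and lcs: "is_lcs (pre @ x @ [marker a] @ y @ post) (static_string D) ans"
  shows "path_open D a x y \<longleftrightarrow> snd (snd ans) < d + 2"
proof -
  let ?S = "pre @ x @ [marker a] @ y @ post"
  have "marker (Suc A) \<notin> set ?S"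
    using assms by (auto simp: filler_letters_def nodes_def)
  then have "sublist v (static_string D) \<longleftrightarrow> v \<in> set (closed_words D)"
    if "sublist v ?S" "length v = d + 2" for v
  proof -
    have "v \<noteq> []" "marker (Suc A) \<notin> set v"
      using that \<open>marker (Suc A) \<notin> set ?S\<close> set_mono_sublist by fastforce+
    then have "sublist v (static_string D) \<longleftrightarrow> (\<exists>e\<in>set (closed_words D). sublist v e)"
      unfolding static_string_def by (rule sublist_concat_terminated_iff)
    also have "\<dots> \<longleftrightarrow> v \<in> set (closed_words D)"
      using that(2) by (metis length_closed_word sublist_order.order.refl sublist_same_length)
    finally show ?thesis .
  qed
  then have "d + 2 \<le> snd (snd ans) \<longleftrightarrow> (\<exists>v\<in>set (closed_words D). sublist v ?S)"
    unfolding lcs_length_ge_iff[OF lcs] using length_closed_word by blast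
  then show ?thesis
    using path_open_iff_no_closed_word[OF assms(1-5)] by fastforce
qed

lemma str_n_template:
  assumes "((2 * b) ^ d)\<^sup>2 * (2 * d + 1) \<le> n" "marker A < n"
  shows "str_n n template"
  using assms set_template_subset by (auto simp: str_n_def length_template filler_letters_def)

lemma str_n_static_string:
  assumes "A * d * (2 * b) ^ (d + 1) * (d + 3) \<le> n" "marker A + 2 \<le> n"
  shows "str_n n (static_string D)"
  using assms set_static_string_subset[of D] length_static_string_le[of D]
  by (auto simp: str_n_def)

lemma reachability_structure_of_lcs_ds:
  assumes ds: "lcs_ds n s w init upd t"
    and template: "str_n n template" and static: "\<And>D. str_n n (static_string D)"
    and letters_fit: "marker A < n"
  obtains pos where "reachability_structure A d b s w t (\<lambda>D. init template (static_string D))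
    (\<lambda>a x y. upd (pos x y) (marker a)) (\<lambda>ans. snd (snd ans) < d + 2)"
proof -
  obtain pos where pos: "\<And>x y. x \<in> nodes \<Longrightarrow> y \<in> nodes \<Longrightarrow>
    \<exists>pre post. pos x y < length template \<and> set pre \<subseteq> filler_letters \<and> set post \<subseteq> filler_letters \<and>
      (\<forall>l. template[pos x y := l] = pre @ x @ [l] @ y @ post)"
    using template_update by metis
  show thesis
  proof (rule that[of pos], unfold_locales)
    show "0 < s"
      using ds by (simp add: lcs_ds_def)
    fix D a x y assume query: "a < A" "x \<in> nodes" "y \<in> nodes"
    obtain pre post where block: "pos x y < length template" "set pre \<subseteq> filler_letters"
      "set post \<subseteq> filler_letters" "template[pos x y := marker a] = pre @ x @ [marker a] @ y @ post"
      using pos[OF query(2,3)] by blast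
    have "marker a < n"
      using query(1) letters_fit by simp
    note update = lcs_ds_first_update[OF ds template static[of D] block(1) this]
    show "cost s w (upd (pos x y) (marker a)) (init template (static_string D)) \<le> t"
      by (rule update)
    show "snd (snd (answer s w (upd (pos x y) (marker a)) (init template (static_string D))))
      < d + 2 \<longleftrightarrow> path_open D a x y"
      using path_open_iff_lcs_length[OF query(2,3,1) block(2,3) update(1)[unfolded block(4)]]
      by simp
  qed
qed

theorem lcs_ds_probe_bound:
  fixes \<sigma> :: real
  assumes "lcs_ds n s w init upd t"
    and "0 < A" "0 < b" "0 < d"
    and "((2 * b) ^ d)\<^sup>2 * (2 * d + 1) \<le> n"
    and "A * d * (2 * b) ^ (d + 1) * (d + 3) \<le> n"
    and letters_fit: "2 * b + A + 2 \<le> n"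
    and "1 \<le> \<sigma>" "real s \<le> \<sigma> * real num_queries"
  shows "real d * ln (real b) \<le> 12 + 12 * real t * ln \<sigma> + 4 * real t * real w / sqrt (real b)"
proof -
  have "marker A < n"
    using letters_fit by simp
  with assms obtain pos where
    "reachability_structure A d b s w t (\<lambda>D. init template (static_string D))
      (\<lambda>a x y. upd (pos x y) (marker a)) (\<lambda>ans. snd (snd ans) < d + 2)"
    by (metis reachability_structure_of_lcs_ds str_n_template str_n_static_string)
  then show ?thesis
    by (rule reachability_structure.probe_bound) fact+
qed

end

subsection \<open>Choice of parameters\<close>

locale large_length =
  fixes n :: nat and L :: real
  assumes L_eq: "L = ln (real n)"
    and one_le_ln_L: "1 \<le> ln L"
    and ln_L_le: "294 * ln L \<le> L"
    and L_power_le_exp: "L ^ 10 \<le> exp (L / 2)"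
begin

text \<open>The depth is chosen such that \<open>(2 * half_degree) ^ depth \<le> L ^ (7 * depth) \<le> exp (L / 6)\<close>, and
  rounding reduces it to no less than \<open>L / (49 * ln L)\<close> as \<open>1 / 42 - 1 / 49 = 1 / 294\<close>. The half
  degree exceeds the square of the word size, so that the term in \<open>w\<close> of the probe bound is only
  \<open>O(t)\<close>.\<close>

definition half_degree :: nat where
  "half_degree = nat \<lceil>L ^ 6\<rceil>"

definition depth :: nat where
  "depth = nat \<lfloor>L / (42 * ln L)\<rfloor>"

definition words_length :: nat where
  "words_length = depth * (2 * half_degree) ^ (depth + 1) * (depth + 3)"

definition copies :: nat where
  "copies = n div words_length"

lemma L_ge: "294 \<le> L"
  using one_le_ln_L ln_L_le by linarith

lemma L_square_ge: "294 * L \<le> L\<^sup>2"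
  using L_ge by (simp add: power2_eq_square)

lemma exp_L: "exp L = real n"
  using one_le_ln_L by (cases "n = 0") (simp_all add: L_eq)

lemma
  shows half_degree_ge: "L ^ 6 \<le> real half_degree"
    and half_degree_le: "2 * real half_degree \<le> L ^ 7"
    and half_degree_pos: "0 < half_degree"
proof -
  have one_le_L6: "1 \<le> L ^ 6"
    using L_ge by (intro one_le_power) auto
  then show "L ^ 6 \<le> real half_degree" "0 < half_degree"
    unfolding half_degree_def by linarith+
  have "2 * real half_degree \<le> 4 * L ^ 6"
    using one_le_L6 unfolding half_degree_def by linarith
  also have "\<dots> \<le> L * L ^ 6"
    using L_ge by (intro mult_right_mono) auto
  finally show "2 * real half_degree \<le> L ^ 7"
    by (simp flip: power_Suc)
qed

lemma ln_half_degree_ge: "6 * ln L \<le> ln (real half_degree)"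
proof -
  have "6 * ln L = ln (L ^ 6)"
    using L_ge by (simp add: ln_realpow)
  also have "\<dots> \<le> ln (real half_degree)"
    using L_ge half_degree_ge by (intro ln_mono) auto
  finally show ?thesis .
qed

lemma L_power_le_sqrt_half_degree: "L ^ 3 \<le> sqrt (real half_degree)"
  using half_degree_ge L_ge by (intro real_le_rsqrt) (simp flip: power_mult)

lemma
  shows depth_ge: "L / (49 * ln L) \<le> real depth"
    and depth_mult_ln_le: "real depth * (7 * ln L) \<le> L / 6"
    and depth_le: "real depth \<le> L"
    and depth_pos: "0 < depth"
proof -
  have quotient: "L / (42 * ln L) = L / (49 * ln L) + L / (294 * ln L)"
    "L / (49 * ln L) = 6 * (L / (294 * ln L))"
    using one_le_ln_L by (simp_all add: field_simps)
  have "1 \<le> L / (294 * ln L)"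
    using one_le_ln_L ln_L_le by simp
  then show depth_ge: "L / (49 * ln L) \<le> real depth" and "0 < depth"
    using quotient unfolding depth_def by linarith+
  have "0 \<le> L / (42 * ln L)"
    using one_le_ln_L L_ge by simp
  then have depth_le_quotient: "real depth \<le> L / (42 * ln L)"
    unfolding depth_def by linarith
  then show depth_mult: "real depth * (7 * ln L) \<le> L / 6"
    using one_le_ln_L by (simp add: field_simps)
  have "real depth * 7 \<le> real depth * (7 * ln L)"
    using one_le_ln_L by (intro mult_left_mono) auto
  with depth_mult show "real depth \<le> L"
    using L_ge by linarith
qed

lemma num_nodes_le: "real ((2 * half_degree) ^ depth) \<le> exp (L / 6)"
proof -
  have "real ((2 * half_degree) ^ depth) = (2 * real half_degree) ^ depth"
    by simp
  also have "\<dots> \<le> (L ^ 7) ^ depth"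
    using half_degree_le by (intro power_mono) auto
  also have "\<dots> = exp (real depth * (7 * ln L))"
    using L_ge by (simp add: exp_of_nat_mult exp_of_nat_mult[of 7 "ln L", simplified])
  also have "\<dots> \<le> exp (L / 6)"
    using depth_mult_ln_le by simp
  finally show ?thesis .
qed

lemma polylog_overhead_le: "4 * real half_degree * real depth * (real depth + 3) \<le> L ^ 10"
proof -
  have "4 * real half_degree * real depth * (real depth + 3)
      = (2 * real half_degree) * (real depth * (2 * (real depth + 3)))"
    by simp
  also have "\<dots> \<le> L ^ 7 * (L * (2 * (L + 3)))"
    using half_degree_le depth_le L_ge by (intro mult_mono) auto
  also have "\<dots> \<le> L ^ 7 * (L * L\<^sup>2)"
    using L_ge L_square_ge by (intro mult_left_mono) auto
  also have "\<dots> = L ^ 10"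
    by (simp add: eval_nat_numeral)
  finally show ?thesis .
qed

lemma exp_2_thirds_L_le: "2 * exp (2 * L / 3) \<le> real n"
proof -
  have "2 \<le> exp (L / 3)"
    using exp_ge_add_one_self[of "L / 3"] L_ge by linarith
  then have "2 * exp (2 * L / 3) \<le> exp (L / 3) * exp (2 * L / 3)"
    by (intro mult_right_mono) auto
  also have "\<dots> = real n"
    by (simp flip: exp_add exp_L)
  finally show ?thesis .
qed

lemma words_length_eq:
  "2 * real words_length
    = 4 * real half_degree * real depth * (real depth + 3) * real ((2 * half_degree) ^ depth)"
proof -
  have "words_length = 2 * half_degree * depth * (depth + 3) * (2 * half_degree) ^ depth"
    by (simp only: words_length_def power_add power_one_right mult_ac)
  then have "real words_length
      = 2 * real half_degree * real depth * (real depth + 3) * real ((2 * half_degree) ^ depth)"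
    by (simp only: of_nat_mult of_nat_add of_nat_numeral)
  then show ?thesis
    by linarith
qed

lemma words_length_le: "2 * real words_length \<le> real n"
proof -
  have "2 * real words_length \<le> L ^ 10 * exp (L / 6)"
    unfolding words_length_eq using polylog_overhead_le num_nodes_le L_ge
    by (intro mult_mono) auto
  also have "\<dots> \<le> exp (L / 2) * exp (L / 6)"
    using L_power_le_exp by (intro mult_right_mono) auto
  also have "\<dots> = exp (2 * L / 3)"
    by (simp flip: exp_add)
  also have "\<dots> \<le> real n"
    using exp_2_thirds_L_le exp_gt_zero[of "2 * L / 3"] by linarith
  finally show ?thesis .
qed

lemma words_length_ge: "8 \<le> words_length"
proof -
  have "(2 * half_degree) ^ 1 \<le> (2 * half_degree) ^ (depth + 1)"
    using half_degree_pos by (intro power_increasing) auto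
  then have "1 * 2 * 4 \<le> words_length"
    unfolding words_length_def using depth_pos half_degree_pos by (intro mult_le_mono) auto
  then show ?thesis
    by simp
qed

lemma copies_mult_le: "copies * words_length \<le> n"
  by (simp add: copies_def)

lemma le_copies_mult: "real n \<le> real copies * (2 * real words_length)"
proof -
  have "n < copies * words_length + words_length"
    using words_length_ge mod_less_divisor[of words_length n] div_mult_mod_eq[of n words_length]
    unfolding copies_def by linarith
  then have "real n < real copies * real words_length + real words_length"
    by (simp flip: of_nat_mult of_nat_add)
  then show ?thesis
    using words_length_le by linarith
qed

lemma copies_pos: "0 < copies"
  using le_copies_mult exp_gt_zero[of L] by (intro gr0I) (simp add: exp_L)

lemma template_fits: "((2 * half_degree) ^ depth)\<^sup>2 * (2 * depth + 1) \<le> n"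
proof -
  have "2 * L + 1 \<le> L\<^sup>2"
    using L_ge L_square_ge by linarith
  also have "\<dots> \<le> L ^ 10"
    using L_ge by (intro power_increasing) auto
  finally have "2 * real depth + 1 \<le> exp (L / 2)"
    using depth_le L_power_le_exp by linarith
  then have "(real ((2 * half_degree) ^ depth))\<^sup>2 * (2 * real depth + 1)
      \<le> (exp (L / 6))\<^sup>2 * exp (L / 2)"
    using num_nodes_le by (intro mult_mono power_mono) auto
  also have "\<dots> = exp (5 * L / 6)"
    by (simp flip: exp_double exp_add)
  also have "\<dots> \<le> exp L"
    using L_ge by simp
  finally have "real (((2 * half_degree) ^ depth)\<^sup>2 * (2 * depth + 1)) \<le> real n"
    by (simp add: exp_L algebra_simps)
  then show ?thesis
    by (simp only: of_nat_le_iff)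
qed

lemma letters_fit: "2 * half_degree + copies + 2 \<le> n"
proof -
  have "8 * copies \<le> n"
    using copies_mult_le mult_le_mono2[OF words_length_ge, of copies] by linarith
  then have "8 * real copies \<le> real n"
    by (metis of_nat_le_iff of_nat_mult of_nat_numeral)
  moreover have "L ^ 7 \<le> L ^ 10"
    using L_ge by (intro power_increasing) auto
  moreover have "2 \<le> exp (L / 6)" "2 \<le> exp (L / 2)"
    using L_ge exp_ge_add_one_self[of "L / 6"] exp_ge_add_one_self[of "L / 2"] by linarith+
  then have "2 * exp (L / 2) \<le> exp (L / 6) * exp (L / 2)"
    by (intro mult_right_mono) auto
  then have "2 * exp (L / 2) \<le> exp (2 * L / 3)"
    by (simp flip: exp_add)
  ultimately have "2 * real half_degree + real copies + 2 \<le> real n"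
    using \<open>2 \<le> exp (L / 2)\<close> \<open>2 * exp (L / 2) \<le> exp (2 * L / 3)\<close>
      half_degree_le L_power_le_exp exp_2_thirds_L_le
    by linarith
  then show ?thesis
    by linarith
qed

lemma
  shows log_length_ge_one: "1 \<le> log 2 (real n)"
    and log_length_le: "log 2 (real n) \<le> 2 * L"
    and log_length_le_square: "log 2 (real n) \<le> L\<^sup>2"
proof -
  have "ln (2 :: real) \<le> 1"
    using ln_le_minus_one[of "2 :: real"] by simp
  have log_eq: "log 2 (real n) = L / ln 2"
    by (simp add: log_def L_eq)
  show "1 \<le> log 2 (real n)"
    using \<open>ln 2 \<le> 1\<close> L_ge by (simp add: log_eq)
  have "L / ln 2 \<le> L / (1 / 2)"
    using half_le_ln_2 L_ge by (intro divide_left_mono) auto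
  then show "log 2 (real n) \<le> 2 * L"
    by (simp add: log_eq)
  also have "\<dots> \<le> L\<^sup>2"
    using L_ge L_square_ge by linarith
  finally show "log 2 (real n) \<le> L\<^sup>2" .
qed

lemma near_linear_space_le:
  assumes "0 \<le> c" "real s \<le> real n * log 2 (real n) powr c"
  shows "real s \<le> L powr (2 * c + 10) * real (butterfly.num_queries copies depth half_degree)"
proof -
  let ?Q = "real (butterfly.num_queries copies depth half_degree)"
  have "real n \<le> real copies * (2 * real words_length)"
    by (rule le_copies_mult)
  also have "\<dots> = (4 * real half_degree * real depth * (real depth + 3)) * ?Q"
    by (simp add: words_length_eq butterfly.num_queries_eq)
  also have "\<dots> \<le> L ^ 10 * ?Q"
    by (intro mult_right_mono polylog_overhead_le) simp
  finally have "real n \<le> L ^ 10 * ?Q" .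
  moreover have "log 2 (real n) powr c \<le> (L\<^sup>2) powr c"
    using log_length_ge_one log_length_le_square assms(1) by (intro powr_mono2) auto
  ultimately have "real n * log 2 (real n) powr c \<le> (L ^ 10 * ?Q) * (L\<^sup>2) powr c"
    using L_ge by (intro mult_mono) auto
  also have "(L ^ 10 * ?Q) * (L\<^sup>2) powr c = L powr (2 * c + 10) * ?Q"
    using L_ge by (simp add: powr_add powr_powr flip: powr_numeral)
  finally show ?thesis
    using assms(2) by simp
qed

lemma word_size_le:
  assumes "2 * cw \<le> L" "0 < cw" "real w \<le> cw * log 2 (real n)"
  shows "real w \<le> sqrt (real half_degree)"
proof -
  have "real w \<le> cw * (2 * L)"
    using assms(2,3) log_length_le by (meson less_imp_le mult_left_mono order_trans)
  also have "\<dots> = (2 * cw) * L"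
    by simp
  also have "\<dots> \<le> L * L"
    using assms(1) L_ge by (intro mult_right_mono) auto
  also have "\<dots> \<le> L ^ 3"
    using L_ge power_increasing[of 2 3 L] by (simp add: power2_eq_square)
  also have "\<dots> \<le> sqrt (real half_degree)"
    by (rule L_power_le_sqrt_half_degree)
  finally show ?thesis .
qed

lemma lcs_ds_update_time_ge:
  assumes "0 \<le> c" "0 < cw" "2 * cw \<le> L"
    and ds: "lcs_ds n s w init upd t"
    and space: "real s \<le> real n * log 2 (real n) powr c"
    and word: "real w \<le> cw * log 2 (real n)"
  shows "1 / (49 * (6 * c + 31)) * L / ln L \<le> real t"
proof -
  let ?\<sigma> = "L powr (2 * c + 10)"
  have "6 * L / 49 = L / (49 * ln L) * (6 * ln L)"
    using one_le_ln_L by (simp add: field_simps)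
  also have "\<dots> \<le> real depth * ln (real half_degree)"
    using depth_ge ln_half_degree_ge one_le_ln_L by (intro mult_mono) auto
  also have "\<dots> \<le> 12 + 12 * real t * ln ?\<sigma> + 4 * real t * real w / sqrt (real half_degree)"
  proof (rule butterfly.lcs_ds_probe_bound[OF ds copies_pos half_degree_pos depth_pos
        template_fits])
    show "copies * depth * (2 * half_degree) ^ (depth + 1) * (depth + 3) \<le> n"
      using copies_mult_le by (simp only: words_length_def mult.assoc)
    show "1 \<le> ?\<sigma>"
      using L_ge assms(1) by (intro ge_one_powr_ge_zero) auto
  qed (fact letters_fit near_linear_space_le[OF assms(1) space])+
  also have "4 * real t * real w / sqrt (real half_degree) \<le> 4 * real t"
    using word_size_le[OF assms(3,2) word] half_degree_pos
    by (simp add: divide_le_eq mult_left_mono)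
  also have "4 * real t \<le> 4 * real t * ln L"
    using one_le_ln_L mult_left_mono[of 1 "ln L" "4 * real t"] by simp
  also have "12 * real t * ln ?\<sigma> = real t * (24 * c + 120) * ln L"
    by (simp add: ln_powr algebra_simps)
  finally have "6 * L / 49 \<le> 12 + real t * (24 * c + 124) * ln L"
    by (simp add: algebra_simps)
  then have "L / 49 \<le> real t * ((6 * c + 31) * ln L)"
    using L_ge by (simp add: algebra_simps)
  moreover have "0 < (6 * c + 31) * ln L"
    using one_le_ln_L assms(1) by (intro mult_pos_pos) auto
  ultimately have "L / 49 / ((6 * c + 31) * ln L) \<le> real t"
    by (simp only: pos_divide_le_eq)
  then show ?thesis
    by (simp add: mult_ac)
qed

end

lemma eventually_large_length: "\<forall>\<^sub>F n in sequentially. large_length n (ln (real n))"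
proof -
  have "\<forall>\<^sub>F n in sequentially. 1 \<le> ln (ln (real n))"
    "\<forall>\<^sub>F n in sequentially. 294 * ln (ln (real n)) \<le> ln (real n)"
    "\<forall>\<^sub>F n in sequentially. ln (real n) ^ 10 \<le> exp (ln (real n) / 2)"
    by real_asymp+
  then show ?thesis
    by eventually_elim (simp add: large_length_def)
qed

theorem theorem27:
  fixes c cw :: real
  assumes "c \<ge> 0" and "cw > 0"
  shows "\<exists>\<epsilon>>0. \<exists>N::nat. \<forall>n\<ge>N. \<forall>s w init upd t.
           lcs_ds n s w init upd t \<longrightarrow>
           real s \<le> real n * log 2 (real n) powr c \<longrightarrow>
           real w \<le> cw * log 2 (real n) \<longrightarrow>
           real t \<ge> \<epsilon> * ln (real n) / ln (ln (real n))"
proof -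
  define \<epsilon> where "\<epsilon> = 1 / (49 * (6 * c + 31))"
  have "\<forall>\<^sub>F n in sequentially. 2 * cw \<le> ln (real n)"
    by real_asymp
  then have "\<forall>\<^sub>F n in sequentially. large_length n (ln (real n)) \<and> 2 * cw \<le> ln (real n)"
    by (intro eventually_conj eventually_large_length)
  then obtain N where large: "\<forall>n\<ge>N. large_length n (ln (real n)) \<and> 2 * cw \<le> ln (real n)"
    unfolding eventually_sequentially ..
  have "\<epsilon> * ln (real n) / ln (ln (real n)) \<le> real t"
    if "n \<ge> N" "lcs_ds n s w init upd t" "real s \<le> real n * log 2 (real n) powr c"
      "real w \<le> cw * log 2 (real n)" for n s w init upd t
    unfolding \<epsilon>_def
  proof (rule large_length.lcs_ds_update_time_ge[OF _ assms _ that(2-4)])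
    show "large_length n (ln (real n))" "2 * cw \<le> ln (real n)"
      using large that(1) by auto
  qed
  moreover have "0 < \<epsilon>"
    using assms(1) by (simp add: \<epsilon>_def)
  ultimately show ?thesis
    by blast
qed

end
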